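(* Assume $\mathfrak{ap}=\mathfrak s=\mathfrak c$. Then fin-intersecting MAD families exist generically; that is, every almost disjoint family on $\omega$ of cardinality less than $\mathfrak c$ can be extended to (is contained in) a fin-intersecting MAD family on $\omega$.
   Context: An almost disjoint family on $\omega$ is an infinite set $\mathcal A$ of infinite subsets of $\omega$ such that $a\cap b$ is finite for all distinct $a,b\in\mathcal A$; it is MAD if it is not properly contained in any other almost disjoint family on $\omega$. A fin sequence is a function $C:\omega\to[\omega]^{<\omega}\setminus\{\emptyset\}$ with $C(n)\cap C(m)=\emptyset$ whenever $n\neq m$. A collection of sets is centered if every finite nonempty subcollection has infinite intersection. An almost disjoint family $\mathcal A$ is fin-intersecting if for every fin sequence $C$ there exists an infinite $I\subseteq\omega$ such that $\{\{n\in I: a\cap C(n)\neq\emptyset\}: a\in\mathcal A\}\setminus[I]^{<\omega}$ is centered, where $[I]^{<\omega}$ is the set of finite subsets of $I$. $\mathfrak c=2^{\aleph_0}$. $\mathfrak{ap}$ is the least cardinality of an almost disjoint family $\mathcal A$ for which there exists $\mathcal B\subseteq\mathcal A$ such that there is no infinite $c\subseteq\omega$ satisfying: for every $a\in\mathcal A$, $c\cap a$ is infinite iff $a\in\mathcal B$. $\mathfrak s$ is the least cardinality of a collection $\mathcal S$ of infinite subsets of $\omega$ such that for every infinite $X\subseteq\omega$ there is $S\in\mathcal S$ with both $X\cap S$ and $X\setminus S$ infinite. *)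

theory Defs
  imports Main "HOL-Library.Disjoint_Sets" "HOL-Library.Infinite_Set" "HOL-Library.Nat_Bijection"
begin

unbundle cardinal_syntax

definition ad_family :: "nat set set \<Rightarrow> bool" where
  "ad_family \<A> \<longleftrightarrow>
     infinite \<A> \<and> (\<forall>a\<in>\<A>. infinite a) \<and> pairwise (\<lambda>a b. finite (a \<inter> b)) \<A>"

definition mad_family :: "nat set set \<Rightarrow> bool" where
  "mad_family \<A> \<longleftrightarrow> ad_family \<A> \<and> \<not> (\<exists>\<B>. ad_family \<B> \<and> \<A> \<subset> \<B>)"

definition fin_sequence :: "(nat \<Rightarrow> nat set) \<Rightarrow> bool" where
  "fin_sequence C \<longleftrightarrow> (\<forall>n. finite (C n) \<and> C n \<noteq> {}) \<and> disjoint_family C"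

definition centered :: "'a set set \<Rightarrow> bool" where
  "centered \<X> \<longleftrightarrow> (\<forall>\<F>. \<F> \<subseteq> \<X> \<and> finite \<F> \<and> \<F> \<noteq> {} \<longrightarrow> infinite (\<Inter>\<F>))"

definition fin_intersecting :: "nat set set \<Rightarrow> bool" where
  "fin_intersecting \<A> \<longleftrightarrow>
     (\<forall>C. fin_sequence C \<longrightarrow>
        (\<exists>I. infinite I \<and> centered ({{n \<in> I. a \<inter> C n \<noteq> {}} | a. a \<in> \<A>} - Fpow I)))"

text \<open>
  The least cardinality of a set satisfying \<open>P\<close>, a cardinal in the sense of the HOL cardinal
  library. It is unspecified if no set satisfies \<open>P\<close>, and otherwise determined up to
  the equivalence \<open>=o\<close>.
\<close>

definition least_card :: "('a set \<Rightarrow> bool) \<Rightarrow> 'a rel" where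
  "least_card P = (SOME r. (\<exists>A. P A \<and> r = |A| ) \<and> (\<forall>A. P A \<longrightarrow> r \<le>o |A| ))"

lemma least_card:
  assumes "P A0"
  shows "\<exists>A. P A \<and> least_card P = |A|" and "P A \<Longrightarrow> least_card P \<le>o |A|"
proof -
  let ?R = "{|A| | A. P A}"
  have "\<exists>r\<in>?R. \<forall>r'\<in>?R. r \<le>o r'"
    using assms by (intro exists_minim_Card_order) (auto simp: card_of_Card_order)
  then have "\<exists>r. (\<exists>A. P A \<and> r = |A| ) \<and> (\<forall>A. P A \<longrightarrow> r \<le>o |A| )"
    by blast
  from someI_ex[OF this]
  have *: "(\<exists>A. P A \<and> least_card P = |A| ) \<and> (\<forall>A. P A \<longrightarrow> least_card P \<le>o |A| )"
    unfolding least_card_def .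
  show "\<exists>A. P A \<and> least_card P = |A|" using * by blast
  show "P A \<Longrightarrow> least_card P \<le>o |A|" using * by blast
qed

definition continuum :: "(nat \<Rightarrow> bool) rel" where
  "continuum = ctwo ^c natLeq"

definition ap_witness :: "nat set set \<Rightarrow> bool" where
  "ap_witness \<A> \<longleftrightarrow>
     ad_family \<A> \<and>
     (\<exists>\<B>\<subseteq>\<A>. \<not> (\<exists>c. infinite c \<and> (\<forall>a\<in>\<A>. infinite (c \<inter> a) \<longleftrightarrow> a \<in> \<B>)))"

definition ap_card :: "nat set rel" where
  "ap_card = least_card ap_witness"

definition splitting_family :: "nat set set \<Rightarrow> bool" where
  "splitting_family \<S> \<longleftrightarrow>
     (\<forall>S\<in>\<S>. infinite S) \<and>
     (\<forall>X. infinite X \<longrightarrow> (\<exists>S\<in>\<S>. infinite (X \<inter> S) \<and> infinite (X - S)))"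

definition s_card :: "nat set rel" where
  "s_card = least_card splitting_family"

lemma splitting_family_exists: "splitting_family {S. infinite S}"
  unfolding splitting_family_def
proof (intro conjI allI impI)
  fix X :: "nat set" assume X: "infinite X"
  let ?S = "enumerate X ` {n. even n}"
  have inj: "inj (enumerate X)"
    using X strict_mono_enumerate strict_mono_imp_inj_on by blast
  have ev: "infinite {n::nat. even n}"
    by (rule infinite_super[of "range (\<lambda>m. 2 * m)"]) (auto intro!: range_inj_infinite simp: inj_def)
  have od: "infinite {n::nat. odd n}"
    by (rule infinite_super[of "range (\<lambda>m. 2 * m + 1)"]) (auto intro!: range_inj_infinite simp: inj_def)
  have 1: "infinite ?S"
    using ev finite_imageD[OF _ inj_on_subset[OF inj subset_UNIV]] by blast
  have "X - ?S = enumerate X ` {n. odd n}"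
  proof -
    have "UNIV - {n::nat. even n} = {n. odd n}" by auto
    then show ?thesis
      using image_set_diff[OF inj, of UNIV "{n. even n}"] range_enumerate[OF X] by simp
  qed
  moreover have "infinite (enumerate X ` {n. odd n})"
    using od finite_imageD[OF _ inj_on_subset[OF inj subset_UNIV]] by blast
  ultimately have 2: "infinite (X - ?S)" by (rule ssubst)
  have "X \<inter> ?S = ?S"
    using range_enumerate[OF X] by auto
  with 1 2 show "\<exists>S\<in>{S. infinite S}. infinite (X \<inter> S) \<and> infinite (X - S)"
    by (intro bexI[of _ ?S] conjI) simp_all
qed auto

lemma ad_family_exists: "\<exists>\<A>. ad_family \<A>"
proof -
  define f where "f = (\<lambda>k. range (\<lambda>m. prod_encode (k, m)))"
  have inf: "infinite (f k)" for k
    unfolding f_def by (intro range_inj_infinite) (auto simp: inj_def)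
  have disj: "f j \<inter> f k = {}" if "j \<noteq> k" for j k
    using that by (auto simp: f_def)
  have "inj f"
    using inf disj by (metis Int_absorb finite.emptyI injI)
  then have "infinite (range f)"
    by (rule range_inj_infinite)
  then have "ad_family (range f)"
    unfolding ad_family_def pairwise_def using inf disj by (metis finite.emptyI imageE)
  then show ?thesis ..
qed

lemma mad_family_exists: "\<exists>\<A>. mad_family \<A>"
proof -
  obtain \<A>0 where A0: "ad_family \<A>0" using ad_family_exists ..
  let ?Z = "{\<B>. ad_family \<B> \<and> \<A>0 \<subseteq> \<B>}"
  have "\<exists>M\<in>?Z. \<forall>X\<in>?Z. M \<subseteq> X \<longrightarrow> X = M"
  proof (rule subset_Zorn_nonempty)
    show "?Z \<noteq> {}" using A0 by blast
  next
    fix \<C> assume ne: "\<C> \<noteq> {}" and ch: "subset.chain ?Z \<C>"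
    then have sub: "\<And>\<B>. \<B> \<in> \<C> \<Longrightarrow> ad_family \<B> \<and> \<A>0 \<subseteq> \<B>"
      by (auto simp: subset.chain_def)
    then have A: "\<A>0 \<subseteq> \<Union>\<C>" using ne by blast
    have "finite (a \<inter> b)" if "a \<in> \<Union>\<C>" "b \<in> \<Union>\<C>" "a \<noteq> b" for a b
    proof -
      obtain \<B>1 \<B>2 where B: "\<B>1 \<in> \<C>" "a \<in> \<B>1" "\<B>2 \<in> \<C>" "b \<in> \<B>2"
        using \<open>a \<in> \<Union>\<C>\<close> \<open>b \<in> \<Union>\<C>\<close> by blast
      moreover have "\<B>1 \<subseteq> \<B>2 \<or> \<B>2 \<subseteq> \<B>1"
        using ch B by (simp add: subset_chain_def)
      ultimately have "\<exists>\<B>\<in>\<C>. a \<in> \<B> \<and> b \<in> \<B>" by blast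
      then obtain \<B> where "\<B> \<in> \<C>" "a \<in> \<B>" "b \<in> \<B>" by blast
      then show ?thesis
        using sub[of \<B>] \<open>a \<noteq> b\<close> unfolding ad_family_def pairwise_def by blast
    qed
    moreover have "infinite (\<Union>\<C>)"
      using A A0 finite_subset unfolding ad_family_def by blast
    moreover have "\<forall>a\<in>\<Union>\<C>. infinite a"
      using sub unfolding ad_family_def by blast
    ultimately show "\<Union>\<C> \<in> ?Z"
      using A by (simp add: ad_family_def pairwise_def)
  qed
  then obtain \<M> where M: "ad_family \<M>" "\<A>0 \<subseteq> \<M>"
    and max: "\<And>\<B>. ad_family \<B> \<Longrightarrow> \<A>0 \<subseteq> \<B> \<Longrightarrow> \<M> \<subseteq> \<B> \<Longrightarrow> \<B> = \<M>"
    by auto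
  have "\<not> (ad_family \<B> \<and> \<M> \<subset> \<B>)" for \<B>
    using max[of \<B>] M(2) by auto
  with M(1) have "mad_family \<M>" by (simp add: mad_family_def)
  then show ?thesis ..
qed

lemma ap_witness_exists: "\<exists>\<A>. ap_witness \<A>"
proof -
  obtain \<A> where A: "mad_family \<A>" using mad_family_exists ..
  then have ad: "ad_family \<A>" by (simp add: mad_family_def)
  have "\<not> (\<exists>c. infinite c \<and> (\<forall>a\<in>\<A>. infinite (c \<inter> a) \<longleftrightarrow> a \<in> {}))"
  proof
    assume "\<exists>c. infinite c \<and> (\<forall>a\<in>\<A>. infinite (c \<inter> a) \<longleftrightarrow> a \<in> {})"
    then obtain c where c: "infinite c" "\<forall>a\<in>\<A>. finite (c \<inter> a)" by auto
    then have "c \<notin> \<A>" by auto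
    moreover have "ad_family (insert c \<A>)"
      using ad c unfolding ad_family_def by (auto simp: pairwise_insert Int_commute)
    ultimately show False using A unfolding mad_family_def by blast
  qed
  then show ?thesis
    unfolding ap_witness_def using ad by blast
qed

lemma continuum_Pow: "continuum =o |UNIV :: nat set set|"
  unfolding continuum_def cexp_def ctwo_def Field_card_of Field_natLeq
  using ordIso_symmetric[OF card_of_Pow_Func[of "UNIV :: nat set"]] by simp

end

theory Submission
  imports Defs "HOL-Algebra.Free_Abelian_Groups"
begin

text \<open>
  The family is built in \<open>\<cc>\<close> steps, indexed by the sets of natural numbers in a well-order of type
  \<open>\<cc>\<close>. Every step adds countably many sets, so each intermediate family is smaller than \<open>\<cc>\<close>. Along the
  way an infinite set \<open>I\<close> is chosen for every fin sequence \<open>C\<close>, and from then on the infinite traces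
  \<open>{n \<in> I. a \<inter> C n \<noteq> {}}\<close> have to stay centered although new sets keep coming in. The difficulty
  is that a set added later may be forced to live inside \<open>\<Union>(C ` I)\<close>.

  A promise \<open>(C, I)\<close> is therefore made only in one of two situations (\<open>settled\<close>). Either finitely many
  members of the current family cover \<open>\<Union>(C ` I)\<close> up to a finite set; then every further set, being
  almost disjoint from those, has a finite trace. Or infinitely many members have a cofinite trace; then
  for every finite intersection \<open>W\<close> of infinite traces the set \<open>\<Union>(C ` W)\<close> meets infinitely many members
  in an infinite set.

  In the second situation almost disjoint families smaller than \<open>\<aa>\<pp>\<close> are not maximal on
  \<open>\<Union>(C ` W)\<close>, so one can choose there an infinite set \<open>e\<^sub>W\<close> almost disjoint from the family, and do so for
  all promises and all \<open>W\<close> at once, the sets \<open>e\<^sub>W\<close> being almost disjoint from each other. Given a set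
  \<open>Y\<close> almost disjoint from the family, the definition of \<open>\<aa>\<pp>\<close> yields a set \<open>c\<close> that is almost disjoint
  from the family but meets \<open>Y\<close> and each \<open>e\<^sub>W\<close> in an infinite set. The trace of \<open>c\<close> then meets each
  \<open>W\<close> in an infinite set, so adding \<open>c\<close> breaks no promise (\<open>add_set_meeting\<close>). This is how
  maximality is achieved.

  A new promise for \<open>C\<close> is obtained from \<open>\<ss>\<close> (\<open>add_promise\<close>): fewer than \<open>\<ss>\<close> traces do not split some
  infinite \<open>X\<close>, so all traces on \<open>X\<close> are finite or cofinite. If neither situation holds, the part
  of \<open>\<Union>(C ` X)\<close> outside the finitely many members with cofinite trace is infinite and almost disjoint
  from the whole family; a set meeting it is added and \<open>X\<close> is shrunk to the trace of that set. If this never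
  stops, a pseudo-intersection of the sets \<open>X\<close> carries infinitely many cofinite traces.
\<close>

section \<open>Sets smaller than the continuum\<close>

abbreviation small :: "'a set \<Rightarrow> bool" where
  "small X \<equiv> |X| <o |UNIV :: nat set set|"

lemma infinite_nat_sets: "infinite (UNIV :: nat set set)"
  by (simp add: Finite_Set.finite_set)

lemma small_le: "|X| \<le>o |Y| \<Longrightarrow> small Y \<Longrightarrow> small X"
  by (rule ordLeq_ordLess_trans)

lemma small_subset: "X \<subseteq> Y \<Longrightarrow> small Y \<Longrightarrow> small X"
  by (blast intro: small_le card_of_mono1)

lemma small_image: "small X \<Longrightarrow> small (f ` X)"
  by (blast intro: small_le card_of_image)

lemma small_Un: "small X \<Longrightarrow> small Y \<Longrightarrow> small (X \<union> Y)"
  by (rule card_of_Un_ordLess_infinite[OF infinite_nat_sets])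

lemma small_Times: "small X \<Longrightarrow> small Y \<Longrightarrow> small (X \<times> Y)"
  by (rule card_of_Times_ordLess_infinite[OF infinite_nat_sets])

lemma small_countable: "countable X \<Longrightarrow> small X"
proof -
  assume "countable X"
  then have "|X| \<le>o |UNIV :: nat set|"
    by (metis card_of_ordLeq countableE subset_UNIV)
  moreover have "|UNIV :: nat set| <o |UNIV :: nat set set|"
    using card_of_set_type[where ?'a = nat] by simp
  ultimately show ?thesis
    by (rule ordLeq_ordLess_trans)
qed

lemma small_Fpow:
  assumes "infinite X" "small X" shows "small (Fpow X)"
proof -
  obtain f where "bij_betw f (Fpow X) X"
    using eqpoll_Fpow[OF assms(1)] unfolding eqpoll_def by blast
  then have "|Fpow X| =o |X|"
    using card_of_ordIso by blast
  then show ?thesis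
    using assms(2) by (rule ordIso_ordLess_trans)
qed

lemma small_UN_countable:
  assumes "small X" "\<And>x. x \<in> X \<Longrightarrow> countable (N x)"
  shows "small (\<Union>x\<in>X. N x)"
proof -
  have "(\<Union>x\<in>X. N x) \<subseteq> (\<lambda>(x, n). from_nat_into (N x) n) ` (X \<times> (UNIV :: nat set))"
  proof
    fix y assume "y \<in> (\<Union>x\<in>X. N x)"
    then obtain x where x: "x \<in> X" "y \<in> N x" by blast
    then obtain n where "from_nat_into (N x) n = y"
      using assms(2) from_nat_into_surj by metis
    with x show "y \<in> (\<lambda>(x, n). from_nat_into (N x) n) ` (X \<times> UNIV)"
      by force
  qed
  moreover have "small (X \<times> (UNIV :: nat set))"
    using assms(1) small_countable by (intro small_Times) auto
  ultimately show ?thesis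
    using small_subset small_image by blast
qed

section \<open>Traces along a fin sequence\<close>

text \<open>
  The second argument takes a whole set \<open>F\<close>: \<open>trace C I F\<close> is the intersection of the traces of the
  members of \<open>F\<close>, and it is \<open>I\<close> if \<open>F\<close> is empty.
\<close>

definition trace :: "(nat \<Rightarrow> nat set) \<Rightarrow> nat set \<Rightarrow> nat set set \<Rightarrow> nat set" where
  "trace C I F = {n \<in> I. \<forall>a\<in>F. a \<inter> C n \<noteq> {}}"

text \<open>
  Since the sets \<open>C n\<close> are finite, nonempty and pairwise disjoint, infinity of a trace and infinity
  of the intersection with \<open>\<Union>(C ` I)\<close> can be exchanged for each other.
\<close>

lemma finite_trace_iff:
  assumes "fin_sequence C"
  shows "finite (trace C I {a}) \<longleftrightarrow> finite (a \<inter> \<Union>(C ` I))"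
proof
  assume "finite (trace C I {a})"
  moreover have "a \<inter> \<Union>(C ` I) \<subseteq> \<Union>(C ` trace C I {a})"
    by (auto simp: trace_def)
  moreover have "\<And>n. finite (C n)"
    using assms by (simp add: fin_sequence_def)
  ultimately show "finite (a \<inter> \<Union>(C ` I))"
    by (meson finite_UN finite_subset)
next
  assume fin: "finite (a \<inter> \<Union>(C ` I))"
  have "\<forall>n\<in>trace C I {a}. \<exists>x. x \<in> a \<inter> C n"
    by (auto simp: trace_def)
  then obtain f where f: "\<And>n. n \<in> trace C I {a} \<Longrightarrow> f n \<in> a \<inter> C n"
    by metis
  have "inj_on f (trace C I {a})"
  proof (rule inj_onI)
    fix m n assume "m \<in> trace C I {a}" "n \<in> trace C I {a}" "f m = f n"
    then have "C m \<inter> C n \<noteq> {}"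
      using f by (metis IntD2 disjoint_iff)
    then show "m = n"
      using assms by (auto simp: fin_sequence_def disjoint_family_on_def)
  qed
  moreover have "f ` trace C I {a} \<subseteq> a \<inter> \<Union>(C ` I)"
    using f by (auto simp: trace_def)
  ultimately show "finite (trace C I {a})"
    using fin by (meson finite_imageD finite_subset)
qed

text \<open>
  If the infinite traces on \<open>I\<close> are centered, either alternative allows to keep them so: a further set
  necessarily has a finite trace, or it can be chosen to meet each finite intersection of infinite
  traces in an infinite set.
\<close>

definition settled :: "nat set set \<Rightarrow> (nat \<Rightarrow> nat set) \<Rightarrow> nat set \<Rightarrow> bool" where
  "settled \<A> C I \<longleftrightarrow>
     (\<exists>F\<subseteq>\<A>. finite F \<and> finite (\<Union>(C ` I) - \<Union>F)) \<or>
     infinite {a\<in>\<A>. finite (I - trace C I {a})}"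

text \<open>
  The middle clause is centeredness of the infinite traces, phrased in terms of the members instead of
  their traces. It includes \<open>F = {}\<close>, which makes \<open>I\<close> infinite.
\<close>

definition honours :: "nat set set \<Rightarrow> (nat \<Rightarrow> nat set) \<Rightarrow> nat set \<Rightarrow> bool" where
  "honours \<A> C I \<longleftrightarrow>
     fin_sequence C \<and>
     (\<forall>F\<subseteq>\<A>. finite F \<and> (\<forall>a\<in>F. infinite (trace C I {a})) \<longrightarrow> infinite (trace C I F)) \<and>
     settled \<A> C I"

lemma honoursD:
  assumes "honours \<A> C I"
  shows "fin_sequence C" "settled \<A> C I"
    "\<And>F. F \<subseteq> \<A> \<Longrightarrow> finite F \<Longrightarrow> (\<And>a. a \<in> F \<Longrightarrow> infinite (trace C I {a}))
      \<Longrightarrow> infinite (trace C I F)"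
  using assms unfolding honours_def by blast+

lemma honours_infinite: "honours \<A> C I \<Longrightarrow> infinite I"
  using honoursD(3)[of \<A> C I "{}"] by (simp add: trace_def)

lemma honours_centered:
  assumes "honours \<A> C I"
  shows "centered ({{n \<in> I. a \<inter> C n \<noteq> {}} | a. a \<in> \<A>} - Fpow I)"
  unfolding centered_def
proof (intro allI impI)
  fix \<F>
  assume *: "\<F> \<subseteq> {{n \<in> I. a \<inter> C n \<noteq> {}} | a. a \<in> \<A>} - Fpow I \<and> finite \<F> \<and> \<F> \<noteq> {}"
  then have "\<F> \<subseteq> (\<lambda>a. trace C I {a}) ` \<A>"
    by (auto simp: trace_def)
  then obtain F where F: "F \<subseteq> \<A>" "finite F" "\<F> = (\<lambda>a. trace C I {a}) ` F"
    using * finite_subset_image[of \<F> "\<lambda>a. trace C I {a}" \<A>] by blast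
  have "infinite (trace C I {a})" if "a \<in> F" for a
  proof
    assume "finite (trace C I {a})"
    then have "trace C I {a} \<in> Fpow I"
      by (auto simp: Fpow_def trace_def)
    then show False
      using * F(3) that by blast
  qed
  then have "infinite (trace C I F)"
    using honoursD(3)[OF assms F(1,2)] by blast
  moreover have "trace C I F \<subseteq> \<Inter>\<F>"
    using F(3) by (auto simp: trace_def)
  ultimately show "infinite (\<Inter>\<F>)"
    using finite_subset by blast
qed

lemma honours_decided:
  assumes "fin_sequence C" "infinite I" "settled \<A> C I"
    and "\<And>a. a \<in> \<A> \<Longrightarrow> finite (trace C I {a}) \<or> finite (I - trace C I {a})"
  shows "honours \<A> C I"
  unfolding honours_def
proof (intro conjI allI impI assms(1,3))
  fix F assume F: "F \<subseteq> \<A>" "finite F \<and> (\<forall>a\<in>F. infinite (trace C I {a}))"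
  then have "finite (\<Union>a\<in>F. I - trace C I {a})"
    using assms(4) by blast
  moreover have "I - trace C I F \<subseteq> (\<Union>a\<in>F. I - trace C I {a})"
    by (auto simp: trace_def)
  ultimately have "finite (I - trace C I F)"
    by (rule rev_finite_subset)
  then show "infinite (trace C I F)"
    using assms(2) by (metis Diff_infinite_finite)
qed

definition keeps :: "nat set set \<Rightarrow> ((nat \<Rightarrow> nat set) \<times> nat set) set \<Rightarrow> bool" where
  "keeps \<A> \<J> \<longleftrightarrow> ad_family \<A> \<and> (\<forall>(C, I)\<in>\<J>. honours \<A> C I)"

lemma keeps_ad: "keeps \<A> \<J> \<Longrightarrow> ad_family \<A>"
  by (simp add: keeps_def)

lemma keeps_insert: "keeps \<A> \<J> \<Longrightarrow> honours \<A> C I \<Longrightarrow> keeps \<A> (insert (C, I) \<J>)"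
  by (auto simp: keeps_def)

lemma ad_finite_Int:
  "ad_family \<A> \<Longrightarrow> a \<in> \<A> \<Longrightarrow> b \<in> \<A> \<Longrightarrow> a \<noteq> b \<Longrightarrow> finite (a \<inter> b)"
  by (simp add: ad_family_def pairwise_def)

lemma ad_insert:
  assumes "ad_family \<A>" "infinite Y" "\<And>a. a \<in> \<A> \<Longrightarrow> finite (Y \<inter> a)"
  shows "ad_family (insert Y \<A>)"
  using assms unfolding ad_family_def by (auto simp: pairwise_insert Int_commute)

lemma settled_mono:
  assumes "settled \<A> C I" "\<A> \<subseteq> \<B>" shows "settled \<B> C I"
proof -
  have "{a\<in>\<A>. finite (I - trace C I {a})} \<subseteq> {a\<in>\<B>. finite (I - trace C I {a})}"
    using assms(2) by blast
  then show ?thesis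
    using assms unfolding settled_def by (meson finite_subset subset_trans)
qed

text \<open>
  Limit steps of the constructions: a violation of almost disjointness or centeredness involves only
  finitely many sets and one promise, hence shows up at some member of the chain. The chain is a set of
  pairs, ordered by inclusion in both components.
\<close>

lemma keeps_Union:
  assumes ne: "\<P> \<noteq> {}"
    and keeps: "\<And>p. p \<in> \<P> \<Longrightarrow> keeps (fst p) (snd p)"
    and dir: "\<And>p q. p \<in> \<P> \<Longrightarrow> q \<in> \<P> \<Longrightarrow>
      (fst p \<subseteq> fst q \<and> snd p \<subseteq> snd q) \<or> (fst q \<subseteq> fst p \<and> snd q \<subseteq> snd p)"
  shows "keeps (\<Union>(fst ` \<P>)) (\<Union>(snd ` \<P>))"
proof -
  have bound: "\<exists>p\<in>\<P>. F \<subseteq> fst p" if "finite F" "F \<subseteq> \<Union>(fst ` \<P>)" for F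
  proof (rule finite_subset_Union_chain[of F "fst ` \<P>" "UNIV", THEN bexE])
    show "subset.chain UNIV (fst ` \<P>)"
      unfolding subset_chain_def using dir by blast
  qed (use that ne in auto)
  have "ad_family (\<Union>(fst ` \<P>))"
    unfolding ad_family_def pairwise_def
  proof (intro conjI ballI impI)
    obtain p where "p \<in> \<P>" using ne by blast
    then show "infinite (\<Union>(fst ` \<P>))"
      using keeps[of p] unfolding keeps_def ad_family_def by (meson UN_upper finite_subset)
  next
    fix a assume "a \<in> \<Union>(fst ` \<P>)"
    then show "infinite a"
      using keeps unfolding keeps_def ad_family_def by blast
  next
    fix a b assume ab: "a \<in> \<Union>(fst ` \<P>)" "b \<in> \<Union>(fst ` \<P>)" "a \<noteq> b"
    then obtain p where "p \<in> \<P>" "{a, b} \<subseteq> fst p"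
      using bound[of "{a, b}"] by (metis bot.extremum finite.emptyI finite.insertI insert_subset)
    then show "finite (a \<inter> b)"
      using ad_finite_Int[OF keeps_ad[OF keeps], of p a b] ab(3) by simp
  qed
  moreover have "honours (\<Union>(fst ` \<P>)) C I" if CI: "(C, I) \<in> \<Union>(snd ` \<P>)" for C I
  proof -
    obtain p where p: "p \<in> \<P>" "(C, I) \<in> snd p" using CI by auto
    then have h: "honours (fst p) C I"
      using keeps[of p] by (auto simp: keeps_def)
    show ?thesis
      unfolding honours_def
    proof (intro conjI allI impI)
      show "fin_sequence C" using honoursD(1)[OF h] .
      show "settled (\<Union>(fst ` \<P>)) C I"
        using honoursD(2)[OF h] p(1) by (blast intro: settled_mono)
      fix F
      assume F: "F \<subseteq> \<Union>(fst ` \<P>)" "finite F \<and> (\<forall>a\<in>F. infinite (trace C I {a}))"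
      then obtain q where q: "q \<in> \<P>" "F \<subseteq> fst q" using bound by blast
      have "\<exists>r\<in>\<P>. F \<subseteq> fst r \<and> (C, I) \<in> snd r"
        using dir[OF p(1) q(1)] p q by blast
      then obtain r where r: "r \<in> \<P>" "F \<subseteq> fst r" "(C, I) \<in> snd r"
        by blast
      then have "honours (fst r) C I"
        using keeps[of r] by (auto simp: keeps_def)
      then show "infinite (trace C I F)"
        using honoursD(3) r(2) F(2) by blast
    qed
  qed
  ultimately show ?thesis by (auto simp: keeps_def)
qed

lemma pseudo_intersection:
  fixes X :: "nat \<Rightarrow> nat set"
  assumes inf: "\<And>n. infinite (X n)" and dec: "\<And>n. X (Suc n) \<subseteq> X n"
  shows "\<exists>Z. infinite Z \<and> (\<forall>n. finite (Z - X n))"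
proof -
  have "\<exists>z. \<forall>n. z n \<in> X n \<and> z n < z (Suc n)"
  proof (rule dependent_nat_choice)
    show "\<exists>x. x \<in> X 0" using inf[of 0] by (metis ex_in_conv finite.emptyI)
    show "\<exists>y. y \<in> X (Suc n) \<and> x < y" for x n
      using inf[of "Suc n"] unfolding infinite_nat_iff_unbounded by blast
  qed
  then obtain z where z: "\<And>n. z n \<in> X n" "\<And>n. z n < z (Suc n)" by blast
  have "inj z"
    using z(2) by (simp add: strict_mono_Suc_iff strict_mono_imp_inj_on)
  have "range z - X n \<subseteq> z ` {..<n}" for n
  proof
    fix x assume x: "x \<in> range z - X n"
    then obtain m where "x = z m" by blast
    moreover have "m < n"
    proof (rule ccontr)
      assume "\<not> m < n"
      then have "X m \<subseteq> X n" using lift_Suc_antimono_le[of X, OF dec] by simp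
      then have "z m \<in> X n" using z(1) by (rule subsetD)
      then show False using x \<open>x = z m\<close> by simp
    qed
    ultimately show "x \<in> z ` {..<n}" by blast
  qed
  then have "finite (range z - X n)" for n
    using finite_subset by blast
  then show ?thesis
    using range_inj_infinite[OF \<open>inj z\<close>] by blast
qed

section \<open>Extending a small family\<close>

text \<open>
  The two hypotheses on the cardinals enter the construction only in the following form.
\<close>

locale large_ap_and_s =
  assumes no_ap_witness: "small \<A> \<Longrightarrow> \<not> ap_witness \<A>"
    and no_splitting: "small \<S> \<Longrightarrow> \<not> splitting_family \<S>"
begin

lemma weak_separation:
  assumes "ad_family \<A>" "small \<A>" "\<B> \<subseteq> \<A>"
  shows "\<exists>c. infinite c \<and> (\<forall>a\<in>\<A>. infinite (c \<inter> a) \<longleftrightarrow> a \<in> \<B>)"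
proof -
  have "\<forall>\<B>\<subseteq>\<A>. \<exists>c. infinite c \<and> (\<forall>a\<in>\<A>. finite (c \<inter> a) \<longleftrightarrow> a \<notin> \<B>)"
    using no_ap_witness[OF assms(2)] assms(1) by (simp add: ap_witness_def)
  then obtain c where "infinite c" "\<forall>a\<in>\<A>. finite (c \<inter> a) \<longleftrightarrow> a \<notin> \<B>"
    using assms(3) by blast
  then show ?thesis by auto
qed

text \<open>
  The inequality \<open>\<aa>\<pp> \<le> \<aa>\<close> relative to \<open>D\<close>: the traces of \<open>\<A>\<close> on \<open>D\<close> form a small almost disjoint family, and
  weak separation with \<open>\<B> = {}\<close> yields a set almost disjoint from all of them. The complement of \<open>D\<close>,
  if infinite, is put into the family to push that set into \<open>D\<close>.
\<close>

lemma almost_disjoint_subset: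
  assumes ad: "ad_family \<A>" and sm: "small \<A>" and many: "infinite {a\<in>\<A>. infinite (a \<inter> D)}"
  shows "\<exists>e\<subseteq>D. infinite e \<and> (\<forall>a\<in>\<A>. finite (e \<inter> a))"
proof -
  let ?P = "{a\<in>\<A>. infinite (a \<inter> D)}"
  let ?R = "(\<lambda>a. a \<inter> D) ` ?P"
  let ?Q = "?R \<union> {X. X = - D \<and> infinite X}"
  have fin: "finite (a \<inter> b)" if "a \<in> \<A>" "b \<in> \<A>" "a \<noteq> b" for a b
    using ad that by (rule ad_finite_Int)
  have "inj_on (\<lambda>a. a \<inter> D) ?P"
  proof (rule inj_onI)
    fix a b assume ab: "a \<in> ?P" "b \<in> ?P" "a \<inter> D = b \<inter> D"
    then have "a \<inter> D \<subseteq> a \<inter> b" by blast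
    then show "a = b"
      using ab fin[of a b] finite_subset by blast
  qed
  then have "infinite ?R" using many finite_imageD by blast
  have adQ: "ad_family ?Q"
    unfolding ad_family_def pairwise_def
  proof (intro conjI ballI impI)
    show "infinite ?Q" using \<open>infinite ?R\<close> by simp
    show "infinite a" if "a \<in> ?Q" for a using that by blast
    have RR: "finite (x \<inter> y)" if xy: "x \<in> ?R" "y \<in> ?R" "x \<noteq> y" for x y
    proof -
      obtain a b where "a \<in> \<A>" "b \<in> \<A>" "x = a \<inter> D" "y = b \<inter> D"
        using xy(1,2) by blast
      moreover from this have "finite (a \<inter> b)" using fin xy(3) by blast
      ultimately show ?thesis using finite_subset[of "x \<inter> y" "a \<inter> b"] by blast
    qed
    show "finite (x \<inter> y)" if "x \<in> ?Q" "y \<in> ?Q" "x \<noteq> y" for x y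
    proof (cases "x \<in> ?R \<and> y \<in> ?R")
      case True then show ?thesis using RR that(3) by blast
    next
      case False
      then have "x \<inter> y = {}" using that by blast
      then show ?thesis by simp
    qed
  qed
  have smQ: "small ?Q"
  proof (rule small_Un)
    show "small ?R" using sm by (intro small_image) (rule small_subset[of _ \<A>], auto)
    show "small {X. X = - D \<and> infinite X}" 
      by (rule small_countable, rule countable_subset[of _ "{- D}"]) auto
  qed
  define Q where "Q = ?Q"
  have "ad_family Q" "small Q" using adQ smQ by (simp_all only: Q_def)
  then obtain c where "infinite c" "\<forall>q\<in>Q. infinite (c \<inter> q) \<longleftrightarrow> q \<in> {}"
    using weak_separation[of Q "{}"] by auto
  then have c: "infinite c" "\<And>q. q \<in> Q \<Longrightarrow> finite (c \<inter> q)" by simp_all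
  have "finite (c \<inter> - D)"
  proof (cases "finite (- D)")
    case False then show ?thesis using c(2)[of "- D"] by (simp add: Q_def)
  qed blast
  moreover have "c = (c \<inter> D) \<union> (c \<inter> - D)" by blast
  ultimately have "infinite (c \<inter> D)"
    using c(1) by (metis finite_UnI)
  moreover have "finite ((c \<inter> D) \<inter> a)" if "a \<in> \<A>" for a
  proof (cases "a \<in> ?P")
    case True
    then have "finite (c \<inter> (a \<inter> D))" using c(2)[of "a \<inter> D"] unfolding Q_def by blast
    then show ?thesis by (simp add: Int_ac)
  next
    case False
    then have "finite (a \<inter> D)" using that by blast
    then show ?thesis by (rule rev_finite_subset) blast
  qed
  ultimately show ?thesis by blast
qed

text \<open>
  The sets \<open>e k\<close> are chosen along a well-order of type \<open>|K|\<close>. At each step \<open>\<A>\<close> together with the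
  earlier choices is still small, so \<open>almost_disjoint_subset\<close> provides the next set.
\<close>

lemma almost_disjoint_refinement:
  fixes D :: "'k \<Rightarrow> nat set"
  assumes ad: "ad_family \<A>" and sm: "small \<A>" and smK: "small K"
    and many: "\<And>k. k \<in> K \<Longrightarrow> infinite {a\<in>\<A>. infinite (a \<inter> D k)}"
  obtains e where "ad_family (\<A> \<union> e ` K)"
    "\<And>k. k \<in> K \<Longrightarrow> e k \<subseteq> D k"
    "\<And>k. k \<in> K \<Longrightarrow> infinite (e k)"
    "\<And>k a. k \<in> K \<Longrightarrow> a \<in> \<A> \<Longrightarrow> finite (e k \<inter> a)"
proof -
  let ?r = "|K|"
  define P where "P f k x \<longleftrightarrow> (k \<in> K \<longrightarrow> x \<subseteq> D k \<and> infinite x \<and>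
      (\<forall>a\<in>\<A> \<union> f ` Order_Relation.underS ?r k. finite (x \<inter> a)))" for f k and x :: "nat set"
  have wo: "well_order_on K ?r" by (rule card_of_well_order_on)
  have under: "Order_Relation.underS ?r k \<subseteq> K" for k
    by (auto simp: Order_Relation.underS_def) (metis FieldI1 Field_card_of)
  have total: "k = l \<or> l \<in> Order_Relation.underS ?r k \<or> k \<in> Order_Relation.underS ?r l" if "k \<in> K" "l \<in> K" for k l
    using wo that
    unfolding well_order_on_def linear_order_on_def total_on_def Order_Relation.underS_def by blast
  have ad_under: "ad_family (\<A> \<union> f ` L)"
    if f: "\<And>k. k \<in> L \<Longrightarrow> P f k (f k)" and L: "L \<subseteq> K" for f L
    unfolding ad_family_def pairwise_def
  proof (intro conjI ballI impI)
    show "infinite (\<A> \<union> f ` L)" using ad by (simp add: ad_family_def)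
    show "infinite a" if "a \<in> \<A> \<union> f ` L" for a
      using that f L ad unfolding P_def ad_family_def by blast
    show "finite (a \<inter> b)" if ab: "a \<in> \<A> \<union> f ` L" "b \<in> \<A> \<union> f ` L" "a \<noteq> b" for a b
    proof -
      have 1: "finite (a \<inter> b)" if "a \<in> \<A>" "b \<in> \<A>"
        using ad that ab(3) by (rule ad_finite_Int)
      have 2: "finite (f k \<inter> a)" if "k \<in> L" "a \<in> \<A>" for k a
        using f[OF that(1)] L that unfolding P_def by blast
      have 3: "finite (f k \<inter> f l)" if kl: "k \<in> L" "l \<in> L" "f k \<noteq> f l" for k l
      proof -
        consider "l \<in> Order_Relation.underS ?r k" | "k \<in> Order_Relation.underS ?r l"
          using total[of k l] kl L by blast
        then show ?thesis
        proof cases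
          case 1 then show ?thesis using f[OF kl(1)] kl L unfolding P_def by blast
        next
          case 2
          then have "finite (f l \<inter> f k)" using f[OF kl(2)] kl L unfolding P_def by blast
          then show ?thesis by (simp add: Int_commute)
        qed
      qed
      consider "a \<in> \<A>" "b \<in> \<A>" | k where "k \<in> L" "a = f k" "b \<in> \<A>"
        | k where "k \<in> L" "b = f k" "a \<in> \<A>" | k l where "k \<in> L" "l \<in> L" "a = f k" "b = f l"
        using ab(1,2) by blast
      then show ?thesis
      proof cases
        case 3 then show ?thesis using 2[of k a] by (simp add: Int_commute)
      qed (use 1 2 3 ab(3) in simp_all)
    qed
  qed
  have "\<exists>f. \<forall>k. P f k (f k)"
  proof (rule dependent_wf_choice[of "?r - Id"])
    show "wf (?r - Id)" using wo by (simp add: well_order_on_def)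
    fix f g :: "'k \<Rightarrow> nat set" and k x
    assume "\<And>l. (l, k) \<in> ?r - Id \<Longrightarrow> f l = g l"
    then have "f ` Order_Relation.underS ?r k = g ` Order_Relation.underS ?r k"
      by (intro image_cong) (auto simp: Order_Relation.underS_def)
    then show "P f k x = P g k x" by (simp add: P_def)
  next
    fix k and f :: "'k \<Rightarrow> nat set"
    assume f: "\<And>l. (l, k) \<in> ?r - Id \<Longrightarrow> P f l (f l)"
    show "\<exists>x. P f k x"
    proof (cases "k \<in> K")
      case True
      have "ad_family (\<A> \<union> f ` Order_Relation.underS ?r k)"
        using f under by (intro ad_under) (auto simp: Order_Relation.underS_def)
      moreover have "small (\<A> \<union> f ` Order_Relation.underS ?r k)"
        using sm smK under by (intro small_Un small_image) (blast intro: small_subset)+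
      moreover have "infinite {a\<in>\<A> \<union> f ` Order_Relation.underS ?r k. infinite (a \<inter> D k)}"
        by (rule infinite_super[OF _ many[OF True]]) blast
      ultimately have "\<exists>x\<subseteq>D k. infinite x \<and>
          (\<forall>a\<in>\<A> \<union> f ` Order_Relation.underS ?r k. finite (x \<inter> a))"
        by (rule almost_disjoint_subset)
      then show ?thesis
        unfolding P_def by blast
    qed (simp add: P_def)
  qed
  then obtain f where f: "\<And>k. P f k (f k)" by blast
  show thesis
  proof (rule that[of f])
    show "ad_family (\<A> \<union> f ` K)" using f by (intro ad_under) auto
    fix k assume "k \<in> K"
    with f[of k] show "f k \<subseteq> D k" "infinite (f k)" "\<And>a. a \<in> \<A> \<Longrightarrow> finite (f k \<inter> a)"
      by (simp_all add: P_def)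
  qed
qed

text \<open>
  The key step. The set \<open>c\<close> comes from weak separation of \<open>Y\<close> and auxiliary sets \<open>e k\<close> from \<open>\<A>\<close>.
  There is one \<open>e k\<close> below each finite intersection of infinite traces of a promise of the second
  kind, and it forces the trace of \<open>c\<close> to meet that intersection in an infinite set.
\<close>

lemma add_set_meeting:
  assumes keeps: "keeps \<A> \<J>" and smA: "small \<A>" and smJ: "small \<J>"
    and Y: "infinite Y" "\<And>a. a \<in> \<A> \<Longrightarrow> finite (Y \<inter> a)"
  shows "\<exists>c. infinite (c \<inter> Y) \<and> keeps (insert c \<A>) \<J>"
proof -
  have ad: "ad_family \<A>" using keeps by (rule keeps_ad)
  define full where "full = (\<lambda>(C, I). {a\<in>\<A>. finite (I - trace C I {a})})"
  define K where "K = {(p, F) \<in> \<J> \<times> Fpow \<A>. infinite (full p) \<and>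
      (\<forall>a\<in>F. infinite (trace (fst p) (snd p) {a}))}"
  define D where "D = (\<lambda>(p, F). \<Union>(fst p ` trace (fst p) (snd p) F))"
  have "small K"
  proof (rule small_subset)
    show "K \<subseteq> \<J> \<times> Fpow \<A>" by (auto simp: K_def)
    show "small (\<J> \<times> Fpow \<A>)"
      using smJ smA ad by (intro small_Times small_Fpow) (auto simp: ad_family_def)
  qed
  \<comment> \<open>A member with cofinite trace on \<open>I\<close> hits \<open>C n\<close> for almost all \<open>n\<close> in the infinite set \<open>trace C I F\<close>.\<close>
  have many: "infinite {a\<in>insert Y \<A>. infinite (a \<inter> D k)}" if "k \<in> K" for k
  proof -
    obtain C I F where k: "k = ((C, I), F)" by (metis prod.collapse)
    then have hon: "honours \<A> C I" and F: "F \<subseteq> \<A>" "finite F"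
      "\<And>a. a \<in> F \<Longrightarrow> infinite (trace C I {a})" and inf: "infinite (full (C, I))"
      using that keeps by (auto simp: K_def keeps_def Fpow_def)
    have W: "infinite (trace C I F)" using honoursD(3)[OF hon F] by blast
    have "infinite (a \<inter> D k)" if "a \<in> full (C, I)" for a
    proof -
      have "trace C I F - trace C (trace C I F) {a} \<subseteq> I - trace C I {a}"
        by (auto simp: trace_def)
      then have "finite (trace C I F - trace C (trace C I F) {a})"
        using that finite_subset by (auto simp: full_def)
      then have "infinite (trace C (trace C I F) {a})"
        using W by (metis Diff_infinite_finite)
      then show ?thesis
        using finite_trace_iff[OF honoursD(1)[OF hon]] by (simp add: D_def k)
    qed
    then have "full (C, I) \<subseteq> {a\<in>insert Y \<A>. infinite (a \<inter> D k)}"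
      by (auto simp: full_def)
    then show ?thesis using inf finite_subset by blast
  qed
  have "ad_family (insert Y \<A>)" using ad Y by (rule ad_insert)
  moreover have smY: "small (insert Y \<A>)"
    using small_Un[OF small_countable[of "{Y}"] smA] by simp
  ultimately obtain e where e: "ad_family (insert Y \<A> \<union> e ` K)"
    "\<And>k. k \<in> K \<Longrightarrow> e k \<subseteq> D k" "\<And>k. k \<in> K \<Longrightarrow> infinite (e k)"
    "\<And>k a. k \<in> K \<Longrightarrow> a \<in> insert Y \<A> \<Longrightarrow> finite (e k \<inter> a)"
    using almost_disjoint_refinement[of "insert Y \<A>" K D] \<open>small K\<close> many by blast
  have "small (insert Y \<A> \<union> e ` K)"
    using smY \<open>small K\<close> by (intro small_Un small_image)
  then have "\<exists>c. infinite c \<and>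
      (\<forall>a\<in>insert Y \<A> \<union> e ` K. infinite (c \<inter> a) \<longleftrightarrow> a \<in> insert Y (e ` K))"
    by (intro weak_separation[OF e(1)]) auto
  then obtain c where c: "infinite c"
    "\<And>a. a \<in> insert Y \<A> \<union> e ` K \<Longrightarrow> infinite (c \<inter> a) \<longleftrightarrow> a \<in> insert Y (e ` K)"
    by meson
  have cY: "infinite (c \<inter> Y)" using c(2)[of Y] by blast
  have ce: "infinite (c \<inter> e k)" if "k \<in> K" for k using c(2)[of "e k"] that by blast
  have cA: "finite (c \<inter> a)" if "a \<in> \<A>" for a
  proof -
    have "infinite a" using ad that by (simp add: ad_family_def)
    then have "a \<noteq> Y" "a \<notin> e ` K" using Y(2)[OF that] e(4) that by fastforce+
    then show ?thesis using c(2)[of a] that by blast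
  qed
  have "honours (insert c \<A>) C I" if "(C, I) \<in> \<J>" for C I
  proof -
    have hon: "honours \<A> C I" using keeps that by (auto simp: keeps_def)
    note fs = honoursD(1)[OF hon]
    have "infinite (trace C I F)"
      if F: "F \<subseteq> insert c \<A>" "finite F" "\<forall>a\<in>F. infinite (trace C I {a})" for F
    proof (cases "c \<in> F")
      case False
      then have "F \<subseteq> \<A>" using F(1) by blast
      then show ?thesis using honoursD(3)[OF hon] F by blast
    next
      case True
      \<comment> \<open>If the promise were of the first kind, \<open>c\<close> would have a finite trace.\<close>
      have "infinite (full (C, I))"
      proof (rule ccontr)
        assume "\<not> infinite (full (C, I))"
        then obtain G where G: "G \<subseteq> \<A>" "finite G" "finite (\<Union>(C ` I) - \<Union>G)"
          using honoursD(2)[OF hon] by (auto simp: settled_def full_def)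
        have "c \<inter> \<Union>(C ` I) \<subseteq> (\<Union>(C ` I) - \<Union>G) \<union> (\<Union>a\<in>G. c \<inter> a)" by blast
        moreover have "finite (\<Union>a\<in>G. c \<inter> a)" using G cA by blast
        ultimately have "finite (c \<inter> \<Union>(C ` I))"
          using G(3) by (meson finite_UnI finite_subset)
        then show False using finite_trace_iff[OF fs] F(3) True by blast
      qed
      then have k: "((C, I), F - {c}) \<in> K"
        using F \<open>(C, I) \<in> \<J>\<close> by (auto simp: K_def Fpow_def)
      have "c \<inter> e ((C, I), F - {c}) \<subseteq> c \<inter> \<Union>(C ` trace C I (F - {c}))"
        using e(2)[OF k] by (auto simp: D_def)
      then have "infinite (c \<inter> \<Union>(C ` trace C I (F - {c})))"
        using ce[OF k] finite_subset by blast
      then have "infinite (trace C (trace C I (F - {c})) {c})"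
        using finite_trace_iff[OF fs] by blast
      moreover have "trace C (trace C I (F - {c})) {c} \<subseteq> trace C I F"
        by (auto simp: trace_def)
      ultimately show ?thesis using finite_subset by blast
    qed
    moreover have "settled (insert c \<A>) C I"
      using honoursD(2)[OF hon] by (rule settled_mono) blast
    ultimately show ?thesis using fs by (auto simp: honours_def)
  qed
  moreover have "ad_family (insert c \<A>)" using ad c(1) cA by (rule ad_insert)
  ultimately show ?thesis using cY by (auto simp: keeps_def)
qed

text \<open>
  Shrinking \<open>X\<close> and adding sets is iterated until \<open>\<B>\<close> settles \<open>C\<close> on \<open>X\<close>. All traces on \<open>X\<close> stay finite
  or cofinite throughout, so centeredness on \<open>X\<close> comes for free. If the process runs through all natural
  numbers, then each set added in it has a cofinite trace on every pseudo-intersection \<open>Z\<close>, which settles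
  \<open>C\<close> on \<open>Z\<close>.
\<close>

lemma add_promise:
  assumes keeps: "keeps \<A> \<J>" and smA: "small \<A>" and smJ: "small \<J>" and C: "fin_sequence C"
  shows "\<exists>N I. countable N \<and> keeps (\<A> \<union> N) (insert (C, I) \<J>)"
proof -
  define decided where "decided = (\<lambda>\<B> X. \<forall>a\<in>\<B>. finite (trace C X {a}) \<or> finite (X - trace C X {a}))"
  define state where "state = (\<lambda>(\<B>, X). \<A> \<subseteq> \<B> \<and> countable (\<B> - \<A>) \<and> keeps \<B> \<J> \<and>
      infinite X \<and> decided \<B> X)"
  define step where "step = (\<lambda>(\<B>, X) (\<B>', X'). \<exists>c. c \<notin> \<B> \<and> \<B>' = insert c \<B> \<and>
      X' = trace C X {c})"
  have finish: ?thesis if "state (\<B>, X)" "settled \<B> C X" for \<B> X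
  proof -
    have "honours \<B> C X"
      using that C by (intro honours_decided) (auto simp: state_def decided_def)
    then have "keeps \<B> (insert (C, X) \<J>)"
      using that(1) by (auto simp: state_def intro: keeps_insert)
    moreover have "\<B> = \<A> \<union> (\<B> - \<A>)" using that(1) by (auto simp: state_def)
    ultimately show ?thesis using that(1) by (force simp: state_def)
  qed
  have "\<exists>X. state (\<A>, X)"
  proof -
    \<comment> \<open>Finite traces cannot belong to a splitting family; they are decided on every \<open>X\<close> anyway.\<close>
    let ?S = "{S \<in> (\<lambda>a. trace C UNIV {a}) ` \<A>. infinite S}"
    have "small ?S"
      by (rule small_subset[OF _ small_image[OF smA, of "\<lambda>a. trace C UNIV {a}"]]) blast
    then obtain X where X: "infinite X" "\<And>S. S \<in> ?S \<Longrightarrow> finite (X \<inter> S) \<or> finite (X - S)"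
      using no_splitting[of ?S] unfolding splitting_family_def by blast
    have tr: "trace C X {a} = X \<inter> trace C UNIV {a}" for a
      by (auto simp: trace_def)
    have "decided \<A> X"
      unfolding decided_def
    proof
      fix a assume "a \<in> \<A>"
      then show "finite (trace C X {a}) \<or> finite (X - trace C X {a})"
        using X(2)[of "trace C UNIV {a}"] 
        unfolding tr Diff_Int Diff_cancel Un_empty_left by blast
    qed
    then show ?thesis using keeps X(1) by (auto simp: state_def)
  qed
  then obtain X0 where X0: "state (\<A>, X0)" ..
  show ?thesis
  proof (cases "\<exists>\<B> X. state (\<B>, X) \<and> settled \<B> C X")
    case True then show ?thesis using finish by blast
  next
    case False
    have "\<exists>f. \<forall>n. state (f n) \<and> step (f n) (f (Suc n))"
    proof (rule dependent_nat_choice)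
      show "\<exists>x. state x" using X0 by blast
      fix x and n :: nat assume "state x"
      obtain \<B> X where x: "x = (\<B>, X)" by force
      then have st: "\<A> \<subseteq> \<B>" "countable (\<B> - \<A>)" "keeps \<B> \<J>" "infinite X" "decided \<B> X"
        using \<open>state x\<close> by (auto simp: state_def)
      define B where "B = {a\<in>\<B>. finite (X - trace C X {a})}"
      have "\<not> settled \<B> C X" using False \<open>state x\<close> x by blast
      then have "finite B" "\<forall>F\<subseteq>\<B>. finite F \<longrightarrow> infinite (\<Union>(C ` X) - \<Union>F)"
        by (simp_all add: settled_def B_def)
      moreover have "B \<subseteq> \<B>" by (auto simp: B_def)
      ultimately have B: "finite B" "infinite (\<Union>(C ` X) - \<Union>B)" by simp_all
      \<comment> \<open>Members in \<open>B\<close> are removed from \<open>Y\<close>, and all others have finite traces on \<open>X\<close>.\<close>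
      define Y where "Y = \<Union>(C ` X) - \<Union>B"
      have "finite (Y \<inter> a)" if "a \<in> \<B>" for a
      proof (cases "a \<in> B")
        case True
        then have "Y \<inter> a = {}" by (auto simp: Y_def)
        then show ?thesis by simp
      next
        case False
        then have "finite (trace C X {a})"
          using st(5) that by (auto simp: decided_def B_def)
        then have "finite (a \<inter> \<Union>(C ` X))" using finite_trace_iff[OF C] by blast
        then show ?thesis by (rule rev_finite_subset) (auto simp: Y_def)
      qed
      moreover have "small \<B>"
      proof -
        have "small (\<A> \<union> (\<B> - \<A>))" using smA small_countable[OF st(2)] by (rule small_Un)
        then show ?thesis using st(1) by (simp add: Un_absorb1)
      qed
      moreover have "infinite Y" using B(2) by (simp add: Y_def)
      ultimately obtain c where c: "infinite (c \<inter> Y)" "keeps (insert c \<B>) \<J>"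
        using add_set_meeting[OF st(3) _ smJ, of Y] by blast
      have "c \<notin> \<B>"
        using c(1) \<open>\<And>a. a \<in> \<B> \<Longrightarrow> finite (Y \<inter> a)\<close> by (metis Int_commute)
      let ?X = "trace C X {c}"
      have "infinite (c \<inter> \<Union>(C ` X))"
        by (rule infinite_super[OF _ c(1)]) (auto simp: Y_def)
      then have "infinite ?X" using finite_trace_iff[OF C] by blast
      moreover have "decided (insert c \<B>) ?X"
        unfolding decided_def
      proof
        fix a assume a: "a \<in> insert c \<B>"
        have "trace C ?X {a} \<subseteq> trace C X {a}" "?X - trace C ?X {a} \<subseteq> X - trace C X {a}"
          "?X - trace C ?X {c} = {}"
          by (auto simp: trace_def)
        then show "finite (trace C ?X {a}) \<or> finite (?X - trace C ?X {a})"
          using a st(5) unfolding decided_def by (metis finite.emptyI finite_subset insertE)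
      qed
      moreover have "countable (insert c \<B> - \<A>)"
        by (rule countable_subset[of _ "insert c (\<B> - \<A>)"]) (use st(2) in auto)
      ultimately have "state (insert c \<B>, ?X)"
        using st(1) c(2) by (auto simp: state_def)
      moreover have "step x (insert c \<B>, ?X)"
        using \<open>c \<notin> \<B>\<close> by (auto simp: step_def x)
      ultimately show "\<exists>y. state y \<and> step x y" by blast
    qed
    then obtain f where f: "\<And>n. state (f n)" "\<And>n. step (f n) (f (Suc n))" by blast
    define Bs Xs where "Bs n = fst (f n)" and "Xs n = snd (f n)" for n
    have st: "\<A> \<subseteq> Bs n" "countable (Bs n - \<A>)" "keeps (Bs n) \<J>" "infinite (Xs n)"
      "decided (Bs n) (Xs n)" for n
      using f(1)[of n] unfolding state_def Bs_def Xs_def by (auto simp: case_prod_beta)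
    have "\<exists>c. c \<notin> Bs n \<and> Bs (Suc n) = insert c (Bs n) \<and> Xs (Suc n) = trace C (Xs n) {c}" for n
      using f(2)[of n] unfolding step_def Bs_def Xs_def by (auto simp: case_prod_beta)
    then obtain c where c: "\<And>n. c n \<notin> Bs n" "\<And>n. Bs (Suc n) = insert (c n) (Bs n)"
      "\<And>n. Xs (Suc n) = trace C (Xs n) {c n}"
      by metis
    have Bmono: "Bs m \<subseteq> Bs n" if "m \<le> n" for m n
      using lift_Suc_mono_le[of Bs, OF _ that] c(2) by blast
    have "Xs (Suc n) \<subseteq> Xs n" for n by (simp add: c(3) trace_def)
    then obtain Z where Z: "infinite Z" "\<And>n. finite (Z - Xs n)"
      using pseudo_intersection[of Xs] st(4) by blast
    let ?B = "\<Union>n. Bs n"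
    have "keeps (\<Union>(fst ` range (\<lambda>n. (Bs n, \<J>)))) (\<Union>(snd ` range (\<lambda>n. (Bs n, \<J>))))"
    proof (rule keeps_Union)
      show "keeps (fst p) (snd p)" if "p \<in> range (\<lambda>n. (Bs n, \<J>))" for p
        using that st(3) by auto
      show "(fst p \<subseteq> fst q \<and> snd p \<subseteq> snd q) \<or> (fst q \<subseteq> fst p \<and> snd q \<subseteq> snd p)"
        if pq: "p \<in> range (\<lambda>n. (Bs n, \<J>))" "q \<in> range (\<lambda>n. (Bs n, \<J>))" for p q
      proof -
        obtain m n where "p = (Bs m, \<J>)" "q = (Bs n, \<J>)" using pq by auto
        then show ?thesis using Bmono[of m n] Bmono[of n m] by (cases "m \<le> n") auto
      qed
    qed simp
    then have keepsB: "keeps ?B \<J>" by (simp add: image_image)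
    have "decided ?B Z"
      unfolding decided_def
    proof
      fix a assume "a \<in> ?B"
      then obtain n where "a \<in> Bs n" by blast
      then have "finite (trace C (Xs n) {a}) \<or> finite (Xs n - trace C (Xs n) {a})"
        using st(5) by (auto simp: decided_def)
      moreover have "trace C Z {a} \<subseteq> trace C (Xs n) {a} \<union> (Z - Xs n)"
        "Z - trace C Z {a} \<subseteq> (Xs n - trace C (Xs n) {a}) \<union> (Z - Xs n)"
        by (auto simp: trace_def)
      ultimately show "finite (trace C Z {a}) \<or> finite (Z - trace C Z {a})"
        using Z(2)[of n] by (meson finite_UnI finite_subset)
    qed
    moreover have "settled ?B C Z"
    proof -
      have "inj c"
      proof (rule linorder_injI)
        fix m n :: nat assume "m < n"
        then have "c m \<in> Bs n" using c(2)[of m] Bmono[of "Suc m" n] by auto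
        then show "c m \<noteq> c n" using c(1)[of n] by metis
      qed
      moreover have "range c \<subseteq> {a\<in>?B. finite (Z - trace C Z {a})}"
      proof
        fix a assume "a \<in> range c"
        then obtain n where n: "a = c n" by blast
        have "Z - trace C Z {a} \<subseteq> Z - Xs (Suc n)" by (auto simp: n c(3) trace_def)
        then show "a \<in> {a\<in>?B. finite (Z - trace C Z {a})}"
          using Z(2) finite_subset n c(2)[of n] by blast
      qed
      ultimately show ?thesis
        unfolding settled_def using range_inj_infinite finite_subset by metis
    qed
    moreover have "countable (?B - \<A>)"
    proof -
      have "?B - \<A> = (\<Union>n. Bs n - \<A>)" by blast
      also have "countable \<dots>" using st(2) by (intro countable_UN) auto
      finally show ?thesis .
    qed
    ultimately have "state (?B, Z)"
      using keepsB Z(1) st(1) by (auto simp: state_def)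
    then show ?thesis using finish \<open>settled ?B C Z\<close> by blast
  qed
qed

section \<open>The transfinite construction\<close>

text \<open>
  Each \<open>t\<close> carries two tasks: if \<open>t\<close> is infinite, some member of the family has to meet \<open>t\<close> in an
  infinite set, which gives maximality, and if \<open>t\<close> codes a fin sequence, a promise for it has to be made.
\<close>

lemma extend_to_fin_intersecting:
  assumes ad0: "ad_family \<A>0" and sm0: "small \<A>0"
  shows "\<exists>\<M>. mad_family \<M> \<and> fin_intersecting \<M> \<and> \<A>0 \<subseteq> \<M>"
proof -
  define dec where "dec t = (\<lambda>n. {m. prod_encode (n, m) \<in> t})" for t :: "nat set"
  have dec_surj: "\<exists>t. dec t = C" for C
  proof
    show "dec (prod_encode ` {(n, m). m \<in> C n}) = C"
      by (auto simp: dec_def fun_eq_iff inj_image_mem_iff[OF inj_prod_encode])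
  qed
  let ?r = "|UNIV :: nat set set|"
  have wo: "well_order_on UNIV ?r" by (rule card_of_well_order_on)
  have total: "s = t \<or> s \<in> Order_Relation.underS ?r t \<or> t \<in> Order_Relation.underS ?r s" for s t
    using wo unfolding well_order_on_def linear_order_on_def total_on_def Order_Relation.underS_def by blast
  have trans: "s \<in> Order_Relation.underS ?r u" if "s \<in> Order_Relation.underS ?r t" "t \<in> Order_Relation.underS ?r u" for s t u
    using wo that
    unfolding well_order_on_def linear_order_on_def partial_order_on_def preorder_on_def
      Order_Relation.underS_def trans_def antisym_def by blast
  have small_under: "small (Order_Relation.underS ?r t)" for t
    by (rule card_of_underS) (auto simp: card_of_Card_order)
  \<comment> \<open>The family and the promises produced by the tasks in \<open>L\<close>, where \<open>f s\<close> consists of the sets added and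
    the infinite set chosen at task \<open>s\<close>.\<close>
  define fam where "fam f L = \<A>0 \<union> (\<Union>s\<in>L. fst (f s))"
    for f :: "nat set \<Rightarrow> nat set set \<times> nat set" and L
  define prm where "prm f L = {(dec s, snd (f s)) | s. s \<in> L \<and> fin_sequence (dec s)}"
    for f :: "nat set \<Rightarrow> nat set set \<times> nat set" and L
  define P where "P f t x \<longleftrightarrow> countable (fst x) \<and>
      keeps (fam f (Order_Relation.underS ?r t) \<union> fst x)
        (prm f (Order_Relation.underS ?r t) \<union> (if fin_sequence (dec t) then {(dec t, snd x)} else {})) \<and>
      (infinite t \<longrightarrow> (\<exists>a\<in>fam f (Order_Relation.underS ?r t) \<union> fst x. infinite (a \<inter> t)))"
    for f t x
  have under_Un: "fam f (insert t (Order_Relation.underS ?r t)) = fam f (Order_Relation.underS ?r t) \<union> fst (f t)"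
    "prm f (insert t (Order_Relation.underS ?r t)) =
       prm f (Order_Relation.underS ?r t) \<union> (if fin_sequence (dec t) then {(dec t, snd (f t))} else {})" for f t
    by (auto simp: fam_def prm_def)
  have limit: "keeps (fam f L) (prm f L)"
    if f: "\<And>s. s \<in> L \<Longrightarrow> P f s (f s)" and down: "\<And>s t. t \<in> L \<Longrightarrow> s \<in> Order_Relation.underS ?r t \<Longrightarrow> s \<in> L"
    for f L
  proof -
    define p where "p s = (fam f (insert s (Order_Relation.underS ?r s)), prm f (insert s (Order_Relation.underS ?r s)))" for s
    \<comment> \<open>The initial pair keeps the chain nonempty if \<open>L\<close> is empty.\<close>
    let ?P = "insert (\<A>0, {}) (p ` L)"
    have "keeps (\<Union>(fst ` ?P)) (\<Union>(snd ` ?P))"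
    proof (rule keeps_Union)
      show "keeps (fst q) (snd q)" if "q \<in> ?P" for q
        using that ad0 f by (auto simp: p_def under_Un P_def keeps_def[of \<A>0])
      have mono: "fst (p s) \<subseteq> fst (p t) \<and> snd (p s) \<subseteq> snd (p t)" if "s \<in> Order_Relation.underS ?r t" for s t
      proof -
        have "insert s (Order_Relation.underS ?r s) \<subseteq> insert t (Order_Relation.underS ?r t)"
          using that trans by blast
        then show ?thesis by (auto simp: p_def fam_def prm_def)
      qed
      show "(fst q \<subseteq> fst q' \<and> snd q \<subseteq> snd q') \<or> (fst q' \<subseteq> fst q \<and> snd q' \<subseteq> snd q)"
        if q: "q \<in> ?P" "q' \<in> ?P" for q q'
      proof (cases "q = (\<A>0, {}) \<or> q' = (\<A>0, {})")
        case True
        moreover have "\<A>0 \<subseteq> fst q" "\<A>0 \<subseteq> fst q'" using that by (auto simp: p_def fam_def)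
        ultimately show ?thesis by auto
      next
        case False
        then obtain s t where "q = p s" "q' = p t" using q by blast
        then show ?thesis using total[of s t] mono by blast
      qed
    qed simp
    moreover have "\<Union>(fst ` ?P) = fam f L"
      using down by (auto simp: p_def fam_def)
    moreover have "\<Union>(snd ` ?P) = prm f L"
      using down by (auto simp: p_def prm_def)
    ultimately show ?thesis by simp
  qed
  have "\<exists>f. \<forall>t. P f t (f t)"
  proof (rule dependent_wf_choice[of "?r - Id"])
    show "wf (?r - Id)" using wo by (simp add: well_order_on_def)
    fix f g :: "nat set \<Rightarrow> nat set set \<times> nat set" and t x
    assume "\<And>s. (s, t) \<in> ?r - Id \<Longrightarrow> f s = g s"
    then have eq: "f s = g s" if "s \<in> Order_Relation.underS ?r t" for s
      using that by (auto simp: Order_Relation.underS_def)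
    have "fam f (Order_Relation.underS ?r t) = fam g (Order_Relation.underS ?r t)" "prm f (Order_Relation.underS ?r t) = prm g (Order_Relation.underS ?r t)"
      using eq unfolding fam_def prm_def by force+
    then show "P f t x = P g t x" by (simp add: P_def)
  next
    fix t and f :: "nat set \<Rightarrow> nat set set \<times> nat set"
    assume "\<And>s. (s, t) \<in> ?r - Id \<Longrightarrow> P f s (f s)"
    then have f: "P f s (f s)" if "s \<in> Order_Relation.underS ?r t" for s
      using that by (auto simp: Order_Relation.underS_def)
    let ?A = "fam f (Order_Relation.underS ?r t)" and ?J = "prm f (Order_Relation.underS ?r t)"
    have k: "keeps ?A ?J" using f trans by (intro limit) blast+
    have smA: "small ?A"
      unfolding fam_def
      by (intro small_Un sm0 small_UN_countable small_under) (use f in \<open>simp add: P_def\<close>)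
    have smJ: "small ?J"
      by (rule small_subset[OF _ small_image[OF small_under, of "\<lambda>s. (dec s, snd (f s))" t]])
        (auto simp: prm_def)
    have "\<exists>N. countable N \<and> keeps (?A \<union> N) ?J \<and> (infinite t \<longrightarrow> (\<exists>a\<in>?A \<union> N. infinite (a \<inter> t)))"
    proof (cases "infinite t \<and> (\<forall>a\<in>?A. finite (a \<inter> t))")
      case True
      then obtain c where "infinite (c \<inter> t)" "keeps (insert c ?A) ?J"
        using add_set_meeting[OF k smA smJ, of t] by (metis Int_commute)
      then show ?thesis by (intro exI[of _ "{c}"]) auto
    next
      case False
      then show ?thesis using k by (intro exI[of _ "{}"]) auto
    qed
    then obtain N where N: "countable N" "keeps (?A \<union> N) ?J"
      "infinite t \<longrightarrow> (\<exists>a\<in>?A \<union> N. infinite (a \<inter> t))" by blast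
    have smN: "small (?A \<union> N)" using smA small_countable[OF N(1)] by (rule small_Un)
    show "\<exists>x. P f t x"
    proof (cases "fin_sequence (dec t)")
      case True
      then obtain N' I where N': "countable N'" "keeps ((?A \<union> N) \<union> N') (insert (dec t, I) ?J)"
        using add_promise[OF N(2) smN smJ] by blast
      then have "P f t (N \<union> N', I)"
        using N True by (auto simp: P_def Un_assoc)
      then show ?thesis ..
    next
      case False
      then have "P f t (N, undefined)" using N by (auto simp: P_def)
      then show ?thesis ..
    qed
  qed
  then obtain f where f: "\<And>t. P f t (f t)" by blast
  define \<M> where "\<M> = fam f UNIV"
  have k: "keeps \<M> (prm f UNIV)" unfolding \<M>_def using f by (intro limit) auto
  have "mad_family \<M>"
    unfolding mad_family_def
  proof (intro conjI notI)
    show "ad_family \<M>" using k by (rule keeps_ad)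
    assume "\<exists>\<B>. ad_family \<B> \<and> \<M> \<subset> \<B>"
    then obtain \<B> t where B: "ad_family \<B>" "\<M> \<subseteq> \<B>" "t \<in> \<B>" "t \<notin> \<M>" by blast
    then have "infinite t" by (simp add: ad_family_def)
    then obtain a where a: "a \<in> fam f (Order_Relation.underS ?r t) \<union> fst (f t)" "infinite (a \<inter> t)"
      using f[of t] unfolding P_def by blast
    then have "a \<in> \<M>" by (auto simp: \<M>_def fam_def)
    then have "a \<in> \<B>" "a \<noteq> t" using B(2,4) by auto
    then show False using ad_finite_Int[OF B(1)] B(3) a(2) by blast
  qed
  moreover have "fin_intersecting \<M>"
    unfolding fin_intersecting_def
  proof (intro allI impI)
    fix C assume C: "fin_sequence C"
    obtain t where "dec t = C" using dec_surj by blast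
    then have "(C, snd (f t)) \<in> prm f UNIV" using C by (auto simp: prm_def)
    then have "honours \<M> C (snd (f t))" using k by (auto simp: keeps_def)
    then show "\<exists>I. infinite I \<and> centered ({{n \<in> I. a \<inter> C n \<noteq> {}} | a. a \<in> \<M>} - Fpow I)"
      using honours_infinite honours_centered by blast
  qed
  moreover have "\<A>0 \<subseteq> \<M>" by (simp add: \<M>_def fam_def)
  ultimately show ?thesis by blast
qed

end

theorem theorem14:
  assumes "ap_card =o s_card" and "s_card =o continuum"
  shows "\<forall>\<A>. ad_family \<A> \<and> |\<A>| <o continuum \<longrightarrow>
           (\<exists>\<M>. mad_family \<M> \<and> fin_intersecting \<M> \<and> \<A> \<subseteq> \<M>)"
proof (intro allI impI)
  fix \<A> assume A: "ad_family \<A> \<and> |\<A>| <o continuum"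
  have s: "|UNIV :: nat set set| =o s_card"
    using assms(2) continuum_Pow ordIso_symmetric ordIso_transitive by blast
  have ap: "|UNIV :: nat set set| =o ap_card"
    using s assms(1) ordIso_symmetric ordIso_transitive by blast
  interpret large_ap_and_s
  proof
    fix \<D> :: "nat set set" assume small: "small \<D>"
    show "\<not> ap_witness \<D>"
    proof
      assume "ap_witness \<D>"
      then have "ap_card \<le>o |\<D>|" 
        unfolding ap_card_def using least_card(2)[of ap_witness \<D> \<D>] by blast
      then have "|UNIV :: nat set set| \<le>o |\<D>|" using ap ordIso_ordLeq_trans by blast
      then show False using small not_ordLess_ordLeq by blast
    qed
    show "\<not> splitting_family \<D>"
    proof
      assume "splitting_family \<D>"
      then have "s_card \<le>o |\<D>|" 
        unfolding s_card_def using least_card(2)[of splitting_family \<D> \<D>] by blast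
      then have "|UNIV :: nat set set| \<le>o |\<D>|" using s ordIso_ordLeq_trans by blast
      then show False using small not_ordLess_ordLeq by blast
    qed
  qed
  have "small \<A>" using A continuum_Pow ordLess_ordIso_trans by blast
  then show "\<exists>\<M>. mad_family \<M> \<and> fin_intersecting \<M> \<and> \<A> \<subseteq> \<M>"
    using A extend_to_fin_intersecting by blast
qed

end
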